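(* Let $X$ be a Hausdorff topological space and let $Y$ be a Hausdorff locally convex linear topological space. Let $F$ be a set-valued map from $X$ to $Y$. Then the following are equivalent: (1) $F$ is a minimal cusco map; (2) $F$ has nonempty compact values and there is a quasicontinuous, subcontinuous selection $f: X \to Y$ of $F$ such that $\overline{\mathrm{co}}\,\overline{f}(x) = F(x)$ for every $x \in X$; (3) $F$ has nonempty compact values and there is a hyperplane minimal, subcontinuous selection $f: X \to Y$ of $F$ such that $\overline{\mathrm{co}}\,\overline{f}(x) = F(x)$ for every $x \in X$; (4) $F$ has nonempty compact values and every selection $f: X \to Y$ of $F$ is hyperplane minimal, subcontinuous and satisfies $\overline{\mathrm{co}}\,\overline{f}(x) = F(x)$ for every $x \in X$.
   Context: Linear topological spaces are considered over the reals. A set-valued map (or map) $F$ from $X$ to $Y$ assigns to each $x\in X$ a (possibly empty) subset $F(x)\subset Y$; it is identified with its graph $\{(x,y)\in X\times Y: y\in F(x)\}$. For $U\subset X$, $F(U)=\bigcup\{F(u):u\in U\}$. For maps $F,G$, $G\subset F$ means $G(x)\subset F(x)$ for all $x\in X$. $F$ is upper semicontinuous if for every $x\in X$ and every open $V\supset F(x)$ there is an open neighborhood $U$ of $x$ with $F(U)\subset V$. $F$ is usco if it is upper semicontinuous with nonempty compact values; it is cusco if it is usco and every $F(x)$ is convex. $F$ is minimal cusco if it is cusco and does not properly contain any other cusco map from $X$ to $Y$. A selection of $F$ is a function $f:X\to Y$ with $f(x)\in F(x)$ for all $x\in X$. A function $f:X\to Y$ is quasicontinuous if for every $x\in X$,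 every neighborhood $V$ of $f(x)$ and every open neighborhood $U$ of $x$ there is a nonempty open set $G\subset U$ with $f(G)\subset V$. A function $f:X\to Y$ is subcontinuous if for every $x\in X$ and every net $(x_i)$ in $X$ converging to $x$, the net $(f(x_i))$ has a convergent subnet in $Y$. An open half-space in $Y$ is a set $\{y\in Y: h(y)<\lambda\}$ with $h$ a nonzero continuous linear functional $Y\to\mathbb{R}$ and $\lambda\in\mathbb{R}$. A set-valued map $F$ (in particular a function, regarded as a set-valued map with singleton values) is hyperplane minimal if for every open half-space $W$ in $Y$ and every open $U\subset X$ with $F(U)\cap W\neq\emptyset$ there is a nonempty open $V\subset U$ with $F(V)\subset W$. For a function $f$, $\overline{f}$ denotes the closure of the graph of $f$ in $X\times Y$, and $\overline{f}(x)=\{y\in Y:(x,y)\in\overline{f}\}$. $\overline{\mathrm{co}}\,B$ is the closed convex hull of $B\subset Y$. *)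

theory Defs
  imports "HOL-Analysis.Analysis"
begin

text \<open>
  The second axiom says \<open>convex V\<close> in unfolded form: the overloaded constant is not
  available inside the class specification.
\<close>

class hausdorff_locally_convex = real_vector + topological_ab_group_add + t2_space +
  assumes tendsto_scaleR_Pair:
      "LIM p (nhds c \<times>\<^sub>F nhds x). fst p *\<^sub>R snd p :> nhds (c *\<^sub>R x)"
    and convex_nhds_base_0:
      "open U \<Longrightarrow> 0 \<in> U \<Longrightarrow> \<exists>V. open V \<and> 0 \<in> V \<and> V \<subseteq> U \<and>
         (\<forall>x\<in>V. \<forall>y\<in>V. \<forall>a\<ge>0. \<forall>b\<ge>0. a + b = 1 \<longrightarrow> a *\<^sub>R x + b *\<^sub>R y \<in> V)"

lemma locally_convex_at_0:
  fixes U :: "'a::hausdorff_locally_convex set"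
  assumes "open U" "0 \<in> U"
  shows "\<exists>V. open V \<and> convex V \<and> 0 \<in> V \<and> V \<subseteq> U"
  using convex_nhds_base_0[OF assms] unfolding convex_def by blast

instance real_normed_vector \<subseteq> hausdorff_locally_convex
proof
  fix c :: real and x :: 'a
  show "LIM p (nhds c \<times>\<^sub>F nhds x). fst p *\<^sub>R snd p :> nhds (c *\<^sub>R x)"
    by (intro tendsto_scaleR filterlim_fst filterlim_snd)
next
  fix U :: "'a set"
  assume "open U" "0 \<in> U"
  then obtain e where "e > 0" "ball 0 e \<subseteq> U"
    by (auto simp: open_contains_ball)
  then show "\<exists>V. open V \<and> 0 \<in> V \<and> V \<subseteq> U \<and>
      (\<forall>x\<in>V. \<forall>y\<in>V. \<forall>a\<ge>0. \<forall>b\<ge>0. a + b = 1 \<longrightarrow> a *\<^sub>R x + b *\<^sub>R y \<in> V)"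
    using convex_ball[of 0 e] unfolding convex_def by (intro exI[of _ "ball 0 e"]) auto
qed


section \<open>Nets\<close>

definition directed_set :: "'i set \<Rightarrow> ('i \<times> 'i) set \<Rightarrow> bool" where
  "directed_set D r \<longleftrightarrow> D \<noteq> {} \<and> preorder_on D r \<and>
     (\<forall>a\<in>D. \<forall>b\<in>D. \<exists>c\<in>D. (a, c) \<in> r \<and> (b, c) \<in> r)"

definition net_converges ::
  "'i set \<Rightarrow> ('i \<times> 'i) set \<Rightarrow> ('i \<Rightarrow> 'a::topological_space) \<Rightarrow> 'a \<Rightarrow> bool" where
  "net_converges D r u x \<longleftrightarrow>
     (\<forall>U. open U \<and> x \<in> U \<longrightarrow> (\<exists>d\<in>D. \<forall>e\<in>D. (d, e) \<in> r \<longrightarrow> u e \<in> U))"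

text \<open>
  \<open>subnet_along D r E s \<phi>\<close>: composing a net indexed by \<open>(D, r)\<close> with \<open>\<phi>\<close> gives a subnet
  indexed by \<open>(E, s)\<close> (Kelley's definition; \<open>\<phi>\<close> need not be monotone).
\<close>

definition subnet_along ::
  "'i set \<Rightarrow> ('i \<times> 'i) set \<Rightarrow> 'j set \<Rightarrow> ('j \<times> 'j) set \<Rightarrow> ('j \<Rightarrow> 'i) \<Rightarrow> bool" where
  "subnet_along D r E s \<phi> \<longleftrightarrow> directed_set E s \<and> \<phi> ` E \<subseteq> D \<and>
     (\<forall>d\<in>D. \<exists>k\<in>E. \<forall>e\<in>E. (k, e) \<in> s \<longrightarrow> (d, \<phi> e) \<in> r)"

text \<open>
  HOL cannot quantify over the index types of nets inside a definition, so nets in \<open>X\<close> are indexed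
  here by directed subsets of \<open>'a set \<times> 'a\<close>, and their subnets by directed subsets of
  \<open>('a set \<times> 'a) \<times> 'b set\<close>. The theorem \<open>subcontinuous_any_net\<close> and the lemmas before it show
  that this entails the property for nets over arbitrary index types and that allowing further
  index types for the subnets would make no difference.
\<close>

definition subcontinuous :: "('a::topological_space \<Rightarrow> 'b::topological_space) \<Rightarrow> bool" where
  "subcontinuous f \<longleftrightarrow>
     (\<forall>x. \<forall>(D :: ('a set \<times> 'a) set) r u.
        directed_set D r \<and> net_converges D r u x \<longrightarrow>
        (\<exists>(E :: (('a set \<times> 'a) \<times> 'b set) set) s \<phi> y.
           subnet_along D r E s \<phi> \<and> net_converges E s (\<lambda>e. f (u (\<phi> e))) y))"

lemma convergent_subnet_imp_cluster:
  assumes "subnet_along D r E s \<phi>" "net_converges E s (\<lambda>e. v (\<phi> e)) y"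
    and "open V" "y \<in> V" "d \<in> D"
  shows "\<exists>e\<in>D. (d, e) \<in> r \<and> v e \<in> V"
proof -
  obtain k where k: "k \<in> E" "\<forall>e\<in>E. (k, e) \<in> s \<longrightarrow> (d, \<phi> e) \<in> r"
    using assms by (auto simp: subnet_along_def)
  obtain l where l: "l \<in> E" "\<forall>e\<in>E. (l, e) \<in> s \<longrightarrow> v (\<phi> e) \<in> V"
    using assms unfolding net_converges_def by blast
  obtain e where "e \<in> E" "(k, e) \<in> s" "(l, e) \<in> s"
    using assms(1) k(1) l(1) unfolding subnet_along_def directed_set_def by blast
  then show ?thesis
    using k l assms(1) unfolding subnet_along_def by blast
qed

lemma cluster_imp_convergent_subnet:
  fixes D :: "'i set" and v :: "'i \<Rightarrow> 'b::topological_space"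
  assumes D: "directed_set D r"
    and cl: "\<And>V d. open V \<Longrightarrow> y \<in> V \<Longrightarrow> d \<in> D \<Longrightarrow> \<exists>e\<in>D. (d, e) \<in> r \<and> v e \<in> V"
  shows "\<exists>(E :: ('i \<times> 'b set) set) s \<phi>.
           subnet_along D r E s \<phi> \<and> net_converges E s (\<lambda>e. v (\<phi> e)) y"
proof -
  define E where "E = {(d, V). d \<in> D \<and> open V \<and> y \<in> V \<and> v d \<in> V}"
  define s where "s = {(p, q). p \<in> E \<and> q \<in> E \<and> (fst p, fst q) \<in> r \<and> snd q \<subseteq> snd p}"
  have refl: "(d, d) \<in> r" if "d \<in> D" for d
    using D that by (auto simp: directed_set_def preorder_on_def refl_on_def)
  have tr: "trans r"
    using D by (simp add: directed_set_def preorder_on_def)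
  have inE: "(d, UNIV) \<in> E" if "d \<in> D" for d
    using that by (simp add: E_def)
  have "directed_set E s"
    unfolding directed_set_def
  proof (intro conjI ballI)
    show "E \<noteq> {}"
      using D inE by (auto simp: directed_set_def)
    show "preorder_on E s"
      unfolding preorder_on_def
    proof (intro conjI)
      show "s \<subseteq> E \<times> E" by (auto simp: s_def)
      show "refl_on E s"
        using refl by (auto simp: refl_on_def s_def E_def)
      show "trans s"
        using tr unfolding trans_def s_def by blast
    qed
    fix a b assume ab: "a \<in> E" "b \<in> E"
    then have "fst a \<in> D" "fst b \<in> D" "open (snd a \<inter> snd b)" "y \<in> snd a \<inter> snd b"
      by (auto simp: E_def)
    moreover then obtain c where c: "c \<in> D" "(fst a, c) \<in> r" "(fst b, c) \<in> r"
      using D unfolding directed_set_def by blast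
    ultimately obtain e where e: "e \<in> D" "(c, e) \<in> r" "v e \<in> snd a \<inter> snd b"
      using cl by blast
    let ?p = "(e, snd a \<inter> snd b)"
    have "?p \<in> E"
      using e ab by (auto simp: E_def)
    moreover have "(fst a, e) \<in> r" "(fst b, e) \<in> r"
      using c e tr unfolding trans_def by blast+
    ultimately show "\<exists>c\<in>E. (a, c) \<in> s \<and> (b, c) \<in> s"
      using ab by (intro bexI[of _ ?p]) (auto simp: s_def)
  qed
  moreover have "fst ` E \<subseteq> D" by (auto simp: E_def)
  moreover have "\<exists>k\<in>E. \<forall>e\<in>E. (k, e) \<in> s \<longrightarrow> (d, fst e) \<in> r" if "d \<in> D" for d
    using inE[OF that] by (intro bexI[of _ "(d, UNIV)"]) (auto simp: s_def)
  ultimately have "subnet_along D r E s fst"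
    by (simp add: subnet_along_def)
  moreover have "net_converges E s (\<lambda>e. v (fst e)) y"
    unfolding net_converges_def
  proof (intro allI impI)
    fix U assume U: "open U \<and> y \<in> U"
    obtain d where "d \<in> D" using D by (auto simp: directed_set_def)
    then obtain e where "e \<in> D" "v e \<in> U" using cl U by blast
    then have "(e, U) \<in> E" using U by (simp add: E_def)
    then show "\<exists>k\<in>E. \<forall>e\<in>E. (k, e) \<in> s \<longrightarrow> v (fst e) \<in> U"
      by (intro bexI[of _ "(e, U)"]) (auto simp: s_def E_def)
  qed
  ultimately show ?thesis by blast
qed

theorem subcontinuous_any_net:
  fixes f :: "'a::topological_space \<Rightarrow> 'b::topological_space" and D :: "'i set"
  assumes f: "subcontinuous f" and D: "directed_set D r" and u: "net_converges D r u x"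
  shows "\<exists>(E :: ('i \<times> 'b set) set) s \<phi> y.
           subnet_along D r E s \<phi> \<and> net_converges E s (\<lambda>e. f (u (\<phi> e))) y"
proof -
  define T where "T d = u ` {e \<in> D. (d, e) \<in> r}" for d
  define N where "N = {(A, a). \<exists>d\<in>D. A = T d \<and> a \<in> A}"
  define q where "q = {(p, p'). p \<in> N \<and> p' \<in> N \<and> fst p' \<subseteq> fst p}"
  have refl: "(d, d) \<in> r" if "d \<in> D" for d
    using D that by (auto simp: directed_set_def preorder_on_def refl_on_def)
  have tr: "trans r"
    using D by (simp add: directed_set_def preorder_on_def)
  have inN: "(T d, u d) \<in> N" if "d \<in> D" for d
    using that refl by (auto simp: N_def T_def)
  have T_mono: "T e \<subseteq> T d" if "(d, e) \<in> r" for d e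
    using that tr unfolding T_def trans_def by blast
  have "directed_set N q"
    unfolding directed_set_def
  proof (intro conjI ballI)
    show "N \<noteq> {}" using D inN by (auto simp: directed_set_def)
    show "preorder_on N q"
      unfolding preorder_on_def by (auto simp: q_def refl_on_def trans_def)
    fix a b assume ab: "a \<in> N" "b \<in> N"
    then obtain d d' where d: "d \<in> D" "d' \<in> D" "fst a = T d" "fst b = T d'"
      by (auto simp: N_def)
    then obtain c where c: "c \<in> D" "(d, c) \<in> r" "(d', c) \<in> r"
      using D unfolding directed_set_def by blast
    show "\<exists>c\<in>N. (a, c) \<in> q \<and> (b, c) \<in> q"
      using ab inN[OF c(1)] T_mono[OF c(2)] T_mono[OF c(3)] d(3,4)
      by (intro bexI[of _ "(T c, u c)"]) (auto simp: q_def)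
  qed
  moreover have "net_converges N q snd x"
    unfolding net_converges_def
  proof (intro allI impI)
    fix U assume "open U \<and> x \<in> U"
    then obtain d where d: "d \<in> D" "\<forall>e\<in>D. (d, e) \<in> r \<longrightarrow> u e \<in> U"
      using u unfolding net_converges_def by blast
    then have "T d \<subseteq> U" by (auto simp: T_def)
    then show "\<exists>k\<in>N. \<forall>e\<in>N. (k, e) \<in> q \<longrightarrow> snd e \<in> U"
      using inN[OF d(1)] by (intro bexI[of _ "(T d, u d)"]) (auto simp: q_def N_def)
  qed
  ultimately obtain E :: "(('a set \<times> 'a) \<times> 'b set) set" and s \<phi> y
    where E: "subnet_along N q E s \<phi>" "net_converges E s (\<lambda>e. f (snd (\<phi> e))) y"
    using f unfolding subcontinuous_def by blast
  have "\<exists>e\<in>D. (d, e) \<in> r \<and> f (u e) \<in> V" if V: "open V" "y \<in> V" "d \<in> D" for V d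
  proof -
    obtain p where "p \<in> N" "((T d, u d), p) \<in> q" "f (snd p) \<in> V"
      using convergent_subnet_imp_cluster[OF E(1), of "\<lambda>p. f (snd p)" y V "(T d, u d)"]
        E(2) V inN by blast
    then have "snd p \<in> T d" by (auto simp: q_def N_def)
    then show ?thesis using \<open>f (snd p) \<in> V\<close> by (auto simp: T_def)
  qed
  then have "\<exists>(E :: ('i \<times> 'b set) set) s \<phi>.
      subnet_along D r E s \<phi> \<and> net_converges E s (\<lambda>e. (\<lambda>i. f (u i)) (\<phi> e)) y"
    using D by (intro cluster_imp_convergent_subnet) auto
  then show ?thesis by blast
qed


section \<open>Set-valued maps and functions\<close>

definition upper_semicontinuous ::
  "('a::topological_space \<Rightarrow> 'b::topological_space set) \<Rightarrow> bool" where
  "upper_semicontinuous F \<longleftrightarrow>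
     (\<forall>x V. open V \<and> F x \<subseteq> V \<longrightarrow> (\<exists>U. open U \<and> x \<in> U \<and> (\<Union>u\<in>U. F u) \<subseteq> V))"

definition usco :: "('a::topological_space \<Rightarrow> 'b::topological_space set) \<Rightarrow> bool" where
  "usco F \<longleftrightarrow> upper_semicontinuous F \<and> (\<forall>x. F x \<noteq> {} \<and> compact (F x))"

definition cusco :: "('a::topological_space \<Rightarrow> 'b::hausdorff_locally_convex set) \<Rightarrow> bool" where
  "cusco F \<longleftrightarrow> usco F \<and> (\<forall>x. convex (F x))"

definition minimal_cusco ::
  "('a::topological_space \<Rightarrow> 'b::hausdorff_locally_convex set) \<Rightarrow> bool" where
  "minimal_cusco F \<longleftrightarrow> cusco F \<and> \<not> (\<exists>G. cusco G \<and> (\<forall>x. G x \<subseteq> F x) \<and> G \<noteq> F)"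

definition selection :: "('a \<Rightarrow> 'b set) \<Rightarrow> ('a \<Rightarrow> 'b) \<Rightarrow> bool" where
  "selection F f \<longleftrightarrow> (\<forall>x. f x \<in> F x)"

definition quasicontinuous :: "('a::topological_space \<Rightarrow> 'b::topological_space) \<Rightarrow> bool" where
  "quasicontinuous f \<longleftrightarrow>
     (\<forall>x V U. f x \<in> interior V \<and> open U \<and> x \<in> U \<longrightarrow>
        (\<exists>G. open G \<and> G \<noteq> {} \<and> G \<subseteq> U \<and> f ` G \<subseteq> V))"

definition open_half_space :: "'b::hausdorff_locally_convex set \<Rightarrow> bool" where
  "open_half_space W \<longleftrightarrow>
     (\<exists>(h :: 'b \<Rightarrow> real) c. linear h \<and> continuous_on UNIV h \<and> h \<noteq> (\<lambda>_. 0) \<and> W = {y. h y < c})"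

definition hyperplane_minimal ::
  "('a::topological_space \<Rightarrow> 'b::hausdorff_locally_convex set) \<Rightarrow> bool" where
  "hyperplane_minimal F \<longleftrightarrow>
     (\<forall>W U. open_half_space W \<and> open U \<and> (\<Union>u\<in>U. F u) \<inter> W \<noteq> {} \<longrightarrow>
        (\<exists>V. open V \<and> V \<noteq> {} \<and> V \<subseteq> U \<and> (\<Union>v\<in>V. F v) \<subseteq> W))"

definition graph_closure ::
  "('a::topological_space \<Rightarrow> 'b::topological_space) \<Rightarrow> 'a \<Rightarrow> 'b set" where
  "graph_closure f x = {y. (x, y) \<in> closure {(z, f z) | z. True}}"

definition closed_convex_hull :: "'b::hausdorff_locally_convex set \<Rightarrow> 'b set" where
  "closed_convex_hull B = closure (convex hull B)"

end

theory Submission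
  imports Defs
begin

text \<open>
  If a proper cusco submap \<open>G\<close> of \<open>F\<close> misses a point of \<open>graph_closure f x\<close>, a functional \<open>h\<close>
  separates that point from \<open>G x\<close>; hyperplane minimality of \<open>f\<close> moves \<open>f\<close>, hence \<open>F\<close>, into the
  half-space \<open>h \<le> c\<close> on some open set where \<open>G\<close> lies in \<open>h > c\<close>. Conversely, if \<open>F\<close> is minimal,
  cutting \<open>F\<close> down by a closed half-space over an open set must produce an empty value, which is
  hyperplane minimality of every selection; the closed convex hulls of the closure of the graph of
  a selection form a cusco submap, hence all of \<open>F\<close>. A quasicontinuous selection of \<open>F\<close> is any
  selection of a minimal usco submap.
\<close>

text \<open>Zorn's lemma for the reversed order. Excluding the empty chain lets the lower bounds be
  pointwise infima or intersections over a nonempty family.\<close>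

lemma zorn_minimal:
  fixes A :: "'c::order set"
  assumes ne: "A \<noteq> {}"
    and lb: "\<And>C. C \<subseteq> A \<Longrightarrow> C \<noteq> {} \<Longrightarrow> (\<forall>x\<in>C. \<forall>y\<in>C. x \<le> y \<or> y \<le> x) \<Longrightarrow> \<exists>l\<in>A. \<forall>x\<in>C. l \<le> x"
  shows "\<exists>m\<in>A. \<forall>x\<in>A. x \<le> m \<longrightarrow> x = m"
proof -
  have po: "partial_order_on A (relation_of (\<lambda>x y. y \<le> x) A)"
    by (rule partial_order_on_relation_ofI) auto
  show ?thesis
  proof (rule predicate_Zorn[OF po])
    fix C assume C: "C \<in> Chains (relation_of (\<lambda>x y. y \<le> x) A)"
    show "\<exists>u\<in>A. \<forall>a\<in>C. u \<le> a"
    proof (cases "C = {}")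
      case True
      then show ?thesis using ne by auto
    next
      case False
      have "C \<subseteq> A" "\<forall>x\<in>C. \<forall>y\<in>C. x \<le> y \<or> y \<le> x"
        using C unfolding Chains_def relation_of_def by blast+
      with False lb show ?thesis by blast
    qed
  qed
qed


section \<open>The Hahn-Banach theorem\<close>

text \<open>For positive factors only an inequality is demanded, which is easy to verify for infima;
  applying it to \<open>inverse t\<close> as well recovers equality, as in
  \<open>sublinearD\<close>.\<close>

definition sublinear :: "('b::real_vector \<Rightarrow> real) \<Rightarrow> bool" where
  "sublinear p \<longleftrightarrow> (\<forall>x y. p (x + y) \<le> p x + p y) \<and> (\<forall>x. \<forall>t>0. p (t *\<^sub>R x) \<le> t * p x)"

lemma sublinearD:
  assumes "sublinear p"
  shows "p (x + y) \<le> p x + p y" "t > 0 \<Longrightarrow> p (t *\<^sub>R x) = t * p x" "p 0 = 0" "0 \<le> p x + p (- x)"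
proof -
  show add: "p (x + y) \<le> p x + p y" for x y
    using assms by (auto simp: sublinear_def)
  show hom: "p (t *\<^sub>R x) = t * p x" if "t > 0" for t x
  proof -
    have "p (t *\<^sub>R x) \<le> t * p x"
      using assms that by (auto simp: sublinear_def)
    moreover have "p (inverse t *\<^sub>R (t *\<^sub>R x)) \<le> inverse t * p (t *\<^sub>R x)"
      using assms that unfolding sublinear_def by (meson positive_imp_inverse_positive)
    then have "t * p x \<le> p (t *\<^sub>R x)"
      using that by (simp add: field_simps)
    ultimately show ?thesis by simp
  qed
  show zero: "p 0 = 0"
    using hom[of 2 0] by simp
  show "0 \<le> p x + p (- x)"
    using add[of x "- x"] zero by simp
qed

text \<open>Zorn's lemma applies since a chain of sublinear functionals has its pointwise infimum as
  a lower bound. The infimum is finite because every sublinear \<open>r\<close> below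
  \<open>p\<close> satisfies \<open>- p (- x) \<le> r x\<close>.\<close>

lemma sublinear_minimal_below:
  assumes p: "sublinear (p :: 'b::real_vector \<Rightarrow> real)"
  shows "\<exists>m. sublinear m \<and> m \<le> p \<and> (\<forall>q. sublinear q \<and> q \<le> m \<longrightarrow> q = m)"
proof -
  define A where "A = {q. sublinear q \<and> q \<le> p}"
  have "\<exists>m\<in>A. \<forall>q\<in>A. q \<le> m \<longrightarrow> q = m"
  proof (rule zorn_minimal)
    show "A \<noteq> {}" using p by (auto simp: A_def)
    fix C assume C: "C \<subseteq> A" "C \<noteq> {}" and ch: "\<forall>x\<in>C. \<forall>y\<in>C. x \<le> y \<or> y \<le> x"
    define l where "l x = (INF q\<in>C. q x)" for x
    have low: "l x \<le> q x" if "q \<in> C" for q x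
      unfolding l_def
    proof (rule cINF_lower[OF _ that])
      have "- p (- x) \<le> r x" if "r \<in> C" for r
      proof -
        have r: "sublinear r" "r \<le> p" using C(1) that by (auto simp: A_def)
        show ?thesis
          using sublinearD(4)[OF r(1), of x] le_funD[OF r(2), of "- x"] by linarith
      qed
      then show "bdd_below ((\<lambda>q. q x) ` C)" by (auto simp: bdd_below_def)
    qed
    have great: "c \<le> l x" if "\<And>q. q \<in> C \<Longrightarrow> c \<le> q x" for c x
      unfolding l_def using C(2) that by (rule cINF_greatest)
    have "sublinear l"
      unfolding sublinear_def
    proof (intro conjI allI impI)
      fix x y
      \<comment> \<open>An infimum of sublinear functionals need not be subadditive. In a chain some
        \<open>s\<close> lies below both \<open>q\<close> and \<open>r\<close>, so different
        functionals may stand on the right.\<close>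
      have 1: "l (x + y) \<le> q x + r y" if q: "q \<in> C" and r: "r \<in> C" for q r
      proof -
        obtain s where s: "s \<in> C" "s \<le> q" "s \<le> r" using ch q r by blast
        then have "s (x + y) \<le> s x + s y" using C(1) sublinearD(1)[of s] by (auto simp: A_def)
        then show ?thesis
          using low[OF s(1), of "x + y"] le_funD[OF s(2), of x] le_funD[OF s(3), of y] by linarith
      qed
      have "l (x + y) - r y \<le> l x" if "r \<in> C" for r
        using 1[OF _ that] by (intro great) (simp add: algebra_simps)
      then have "l (x + y) - l x \<le> l y"
        by (intro great) (simp add: algebra_simps)
      then show "l (x + y) \<le> l x + l y" by simp
    next
      fix x and t :: real assume t: "t > 0"
      have "l (t *\<^sub>R x) / t \<le> l x"
      proof (rule great)
        fix q assume q: "q \<in> C"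
        then have "q (t *\<^sub>R x) = t * q x" using C(1) t sublinearD(2)[of q] by (auto simp: A_def)
        then show "l (t *\<^sub>R x) / t \<le> q x" using low[OF q, of "t *\<^sub>R x"] t by (simp add: field_simps)
      qed
      then show "l (t *\<^sub>R x) \<le> t * l x" using t by (simp add: field_simps)
    qed
    moreover have "l \<le> q" if "q \<in> C" for q
      using low[OF that] by (simp add: le_fun_def)
    moreover have "l \<le> p"
    proof -
      obtain q where "q \<in> C" using C(2) by blast
      then have "l \<le> q" "q \<le> p" using \<open>\<And>q. q \<in> C \<Longrightarrow> l \<le> q\<close> C(1) by (auto simp: A_def)
      then show ?thesis by (rule order_trans)
    qed
    ultimately show "\<exists>l\<in>A. \<forall>x\<in>C. l \<le> x" by (auto simp: A_def)
  qed
  then obtain m where m: "sublinear m" "m \<le> p" "\<And>q. sublinear q \<Longrightarrow> q \<le> p \<Longrightarrow> q \<le> m \<Longrightarrow> q = m"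
    unfolding A_def by blast
  have "q = m" if "sublinear q" "q \<le> m" for q
    using that m(2,3) order_trans by blast
  with m(1,2) show ?thesis by blast
qed

text \<open>The functional is \<open>r x = inf {q (x + t a) - t q a | t \<ge> 0}\<close>; take \<open>t = 1\<close> at \<open>x = - a\<close>.\<close>

lemma sublinear_flatten:
  assumes q: "sublinear q"
  obtains r where "sublinear r" "r \<le> q" "r (- a) \<le> - q a"
proof -
  define T :: "real set" where "T = {0..}"
  define g where "g t x = q (x + t *\<^sub>R a) - t * q a" for t x
  define r where "r x = (INF t\<in>T. g t x)" for x
  have qt: "q (t *\<^sub>R a) = t * q a" if "t \<in> T" for t
    using that sublinearD(2,3)[OF q] by (cases "t = 0") (auto simp: T_def)
  have low: "r x \<le> g t x" if "t \<in> T" for t x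
    unfolding r_def
  proof (rule cINF_lower[OF _ that])
    \<comment> \<open>Subadditivity bounds \<open>q (t a)\<close> by
      \<open>q (x + t a) + q (- x)\<close>, and \<open>q (t a) = t * q a\<close> cancels the
      subtracted term, so the bound does not depend on \<open>t\<close>.\<close>
    have "- q (- x) \<le> g t x" if "t \<in> T" for t
      using sublinearD(1)[OF q, of "x + t *\<^sub>R a" "- x"] qt[OF that] by (simp add: g_def)
    then show "bdd_below ((\<lambda>t. g t x) ` T)" by (auto simp: bdd_below_def)
  qed
  have great: "c \<le> r x" if "\<And>t. t \<in> T \<Longrightarrow> c \<le> g t x" for c x
    unfolding r_def using that by (intro cINF_greatest) (auto simp: T_def)
  have "sublinear r"
    unfolding sublinear_def
  proof (intro conjI allI impI)
    fix x y
    have 1: "r (x + y) \<le> g s x + g t y" if s: "s \<in> T" and t: "t \<in> T" for s t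
    proof -
      \<comment> \<open>The parameter \<open>s + t\<close> absorbs both shifts at once.\<close>
      have "s + t \<in> T" using s t by (auto simp: T_def)
      from low[OF this, of "x + y"] sublinearD(1)[OF q, of "x + s *\<^sub>R a" "y + t *\<^sub>R a"]
      show ?thesis by (simp add: g_def algebra_simps)
    qed
    have "r (x + y) - g t y \<le> r x" if "t \<in> T" for t
      using 1[OF _ that] by (intro great) (simp add: algebra_simps)
    then have "r (x + y) - r x \<le> r y"
      by (intro great) (simp add: algebra_simps)
    then show "r (x + y) \<le> r x + r y" by simp
  next
    fix x and c :: real assume c: "c > 0"
    have "r (c *\<^sub>R x) / c \<le> r x"
    proof (rule great)
      fix t assume t: "t \<in> T"
      \<comment> \<open>Scaling the argument by \<open>c\<close> corresponds to the parameter
        \<open>c * t\<close>, which is again nonnegative.\<close>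
      then have "c * t \<in> T" using c by (auto simp: T_def)
      moreover have "q (c *\<^sub>R x + (c * t) *\<^sub>R a) = c * q (x + t *\<^sub>R a)"
        using sublinearD(2)[OF q c, of "x + t *\<^sub>R a"] by (simp add: algebra_simps)
      ultimately have "r (c *\<^sub>R x) \<le> c * g t x"
        using low[of "c * t" "c *\<^sub>R x"] by (simp add: g_def algebra_simps)
      then show "r (c *\<^sub>R x) / c \<le> g t x" using c by (simp add: field_simps)
    qed
    then show "r (c *\<^sub>R x) \<le> c * r x" using c by (simp add: field_simps)
  qed
  moreover have "r \<le> q" using low[of 0] by (auto simp: le_fun_def T_def g_def)
  moreover have "r (- a) \<le> - q a"
    using low[of 1 "- a"] sublinearD(3)[OF q] by (simp add: T_def g_def)
  ultimately show ?thesis by (rule that)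
qed

text \<open>
  By \<open>sublinear_flatten\<close> a minimal sublinear functional is odd, so that subadditivity is additivity.
\<close>

lemma minimal_sublinear_imp_linear:
  assumes m: "sublinear m" and min: "\<And>q. sublinear q \<Longrightarrow> q \<le> m \<Longrightarrow> q = m"
  shows "linear m"
proof -
  have neg: "m (- a) = - m a" for a
  proof -
    obtain r where r: "sublinear r" "r \<le> m" "r (- a) \<le> - m a"
      using sublinear_flatten[OF m] by blast
    then have "r = m" using min by blast
    then show ?thesis using r(3) sublinearD(4)[OF m, of a] by simp
  qed
  show ?thesis
  proof (rule linearI)
    fix x y
    show "m (x + y) = m x + m y"
      using sublinearD(1)[OF m, of x y] sublinearD(1)[OF m, of "- x" "- y"]
        neg[of "x + y"] neg[of x] neg[of y] by simp
  next
    fix c :: real and x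
    consider "c > 0" | "c = 0" | "- c > 0" by linarith
    then show "m (c *\<^sub>R x) = c *\<^sub>R m x"
    proof cases
      case 3
      then show ?thesis using sublinearD(2)[OF m 3, of x] neg[of "c *\<^sub>R x"] by simp
    qed (use sublinearD(2,3)[OF m] in auto)
  qed
qed

text \<open>Flattening at \<open>z\<close> before passing to a minimal functional forces
  \<open>h (- z) \<le> - p z\<close>, that is \<open>p z \<le> h z\<close>; the other inequality is
  \<open>h \<le> p\<close>. One prescribed value suffices for separating a point from a convex
  set.\<close>

theorem hahn_banach_sublinear:
  assumes p: "sublinear p"
  obtains h where "linear h" "h \<le> p" "h z = p z"
proof -
  obtain r where r: "sublinear r" "r \<le> p" "r (- z) \<le> - p z"
    using sublinear_flatten[OF p] by blast
  obtain h where h: "sublinear h" "h \<le> r" "\<And>q. sublinear q \<Longrightarrow> q \<le> h \<Longrightarrow> q = h"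
    using sublinear_minimal_below[OF r(1)] by blast
  have lin: "linear h"
    using h by (intro minimal_sublinear_imp_linear) auto
  have "h \<le> p" using h(2) r(2) by (rule order_trans)
  moreover have "h z = p z"
    using le_funD[OF h(2), of "- z"] r(3) linear_neg[OF lin, of z] le_funD[OF \<open>h \<le> p\<close>, of z]
    by linarith
  ultimately show ?thesis using lin that by blast
qed


section \<open>Locally convex spaces\<close>

lemma continuous_on_scaleR_lc:
  fixes f :: "'c::topological_space \<Rightarrow> real" and g :: "'c \<Rightarrow> 'b::hausdorff_locally_convex"
  assumes "continuous_on S f" "continuous_on S g"
  shows "continuous_on S (\<lambda>x. f x *\<^sub>R g x)"
  unfolding continuous_on_def
proof
  fix x assume "x \<in> S"
  then have "(f \<longlongrightarrow> f x) (at x within S)" "(g \<longlongrightarrow> g x) (at x within S)"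
    using assms by (auto simp: continuous_on_def)
  then have "LIM y (at x within S). (f y, g y) :> nhds (f x) \<times>\<^sub>F nhds (g x)"
    by (rule filterlim_Pair)
  from filterlim_compose[OF tendsto_scaleR_Pair this]
  show "((\<lambda>x. f x *\<^sub>R g x) \<longlongrightarrow> f x *\<^sub>R g x) (at x within S)" by simp
qed

text \<open>Continuity of addition at \<open>(0, 0)\<close> yields a box
  \<open>A \<times> B\<close>; a convex neighbourhood of 0 inside \<open>A \<inter> B\<close>,
  intersected with its negative, is also symmetric. This replaces the halving of epsilon.\<close>

lemma nhds_0_symmetric_convex:
  fixes U :: "'b::hausdorff_locally_convex set"
  assumes "open U" "0 \<in> U"
  obtains W where "open W" "convex W" "0 \<in> W" "\<And>a b. a \<in> W \<Longrightarrow> b \<in> W \<Longrightarrow> a + b \<in> U"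
    "\<And>a. a \<in> W \<Longrightarrow> - a \<in> W"
proof -
  define P where "P = (\<lambda>p::'b \<times> 'b. fst p + snd p) -` U"
  have "open P" unfolding P_def using assms(1)
    by (intro open_vimage continuous_intros)
  moreover have "(0, 0) \<in> P" using assms(2) by (simp add: P_def)
  ultimately obtain A B where AB: "open A" "open B" "(0, 0) \<in> A \<times> B" "A \<times> B \<subseteq> P"
    by (rule open_prod_elim)
  then obtain V where V: "open V" "convex V" "0 \<in> V" "V \<subseteq> A \<inter> B"
    using locally_convex_at_0[of "A \<inter> B"] by (auto simp: open_Int)
  have "open (uminus -` V)" using V(1) by (intro open_vimage continuous_intros)
  moreover have "convex (uminus -` V)"
  proof -
    have "uminus -` V = uminus ` V" by force
    then show ?thesis using convex_negations[OF V(2)] by simp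
  qed
  ultimately show ?thesis
  proof (intro that[of "V \<inter> uminus -` V"])
    fix a b assume "a \<in> V \<inter> uminus -` V" "b \<in> V \<inter> uminus -` V"
    then have "(a, b) \<in> P" using V(4) AB(4) by blast
    then show "a + b \<in> U" by (simp add: P_def)
  qed (use V in \<open>auto simp: convex_Int\<close>)
qed

text \<open>A fixed convex combination is a continuous map on pairs that sends
  \<open>S \<times> S\<close> into \<open>S\<close>, and the closure of \<open>S \<times> S\<close>
  is the product of the closures.\<close>

lemma convex_closure_lc:
  fixes S :: "'b::hausdorff_locally_convex set"
  assumes "convex S"
  shows "convex (closure S)"
  unfolding convex_def
proof (intro ballI allI impI)
  fix x y and u v :: real
  assume xy: "x \<in> closure S" "y \<in> closure S" and uv: "0 \<le> u" "0 \<le> v" "u + v = 1"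
  define g where "g p = u *\<^sub>R fst p + v *\<^sub>R snd p" for p :: "'b \<times> 'b"
  have "continuous_on (closure (S \<times> S)) g"
    unfolding g_def by (intro continuous_intros continuous_on_scaleR_lc)
  moreover have "g ` (S \<times> S) \<subseteq> closure S"
    using convexD[OF assms _ _ uv] closure_subset[of S] by (auto simp: g_def)
  ultimately have "g ` closure (S \<times> S) \<subseteq> closure S"
    by (intro image_closure_subset) auto
  then show "u *\<^sub>R x + v *\<^sub>R y \<in> closure S"
    using xy imageI[of "(x, y)" "closure (S \<times> S)" g] by (auto simp: closure_Times g_def)
qed

text \<open>The sum of \<open>K\<close> and \<open>W\<close> is a union of translates of
  \<open>W\<close>. It is spelled as a double union to fit \<open>convex_sums\<close>.\<close>

lemma open_sums_lc:
  fixes W :: "'b::hausdorff_locally_convex set"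
  assumes "open W"
  shows "open (\<Union>x\<in>K. \<Union>w\<in>W. {x + w})"
proof (rule open_UN, rule ballI)
  fix x
  have "v \<in> (\<Union>w\<in>W. {x + w}) \<longleftrightarrow> v - x \<in> W" for v
    by (metis (no_types, lifting) UN_iff add.commute diff_add_cancel add_diff_cancel_left' singleton_iff)
  then have "(\<Union>w\<in>W. {x + w}) = (\<lambda>v. v - x) -` W" by blast
  moreover have "open ((\<lambda>v. v - x) -` W)"
    using assms by (intro open_vimage continuous_intros)
  ultimately show "open (\<Union>w\<in>W. {x + w})" by simp
qed

text \<open>Compactness gives one neighbourhood \<open>W\<close> of 0 with
  \<open>K + W + W \<subseteq> V\<close>, and \<open>V' = K + W\<close> works. The sum form also
  inherits convexity from \<open>K\<close>, which is needed to enclose closed convex hulls.\<close>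

lemma compact_open_separation:
  fixes K V :: "'b::hausdorff_locally_convex set"
  assumes K: "compact K" and V: "open V" "K \<subseteq> V"
  obtains V' where "open V'" "K \<subseteq> V'" "closure V' \<subseteq> V" "convex K \<Longrightarrow> convex V'"
proof -
  define P where "P = (\<lambda>p::'b \<times> 'b. fst p + snd p) -` V"
  have oP: "open P" unfolding P_def using V(1)
    by (intro open_vimage continuous_intros)
  have "\<forall>k\<in>K. \<exists>A B. open A \<and> open B \<and> k \<in> A \<and> 0 \<in> B \<and> A \<times> B \<subseteq> P"
  proof
    fix k assume "k \<in> K"
    then have "(k, 0) \<in> P" using V(2) by (auto simp: P_def)
    with oP obtain A B where "open A" "open B" "(k, 0) \<in> A \<times> B" "A \<times> B \<subseteq> P"
      by (rule open_prod_elim)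
    then show "\<exists>A B. open A \<and> open B \<and> k \<in> A \<and> 0 \<in> B \<and> A \<times> B \<subseteq> P"
      by blast
  qed
  then obtain A B where AB: "\<And>k. k \<in> K \<Longrightarrow> open (A k) \<and> open (B k) \<and> k \<in> A k \<and> 0 \<in> B k \<and> A k \<times> B k \<subseteq> P"
    by metis
  obtain K' where K': "K' \<subseteq> K" "finite K'" "K \<subseteq> (\<Union>k\<in>K'. A k)"
  proof (rule compactE_image[OF K, of K A])
    show "open (A k)" if "k \<in> K" for k using AB that by blast
    show "K \<subseteq> (\<Union>k\<in>K. A k)" using AB by blast
  qed
  \<comment> \<open>The subcover is finite, so one neighbourhood of 0 serves all of
    \<open>K\<close>. It has to hold \<open>W + W\<close>: one summand builds \<open>V'\<close>, the
    other allows for its closure.\<close>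
  have "open (\<Inter>k\<in>K'. B k)" "0 \<in> (\<Inter>k\<in>K'. B k)"
    using AB K'(1,2) by (blast intro: open_INT)+
  then obtain W where W: "open W" "convex W" "0 \<in> W"
      "\<And>a b. a \<in> W \<Longrightarrow> b \<in> W \<Longrightarrow> a + b \<in> (\<Inter>k\<in>K'. B k)" "\<And>a. a \<in> W \<Longrightarrow> - a \<in> W"
    by (rule nhds_0_symmetric_convex) blast
  have KW: "k + (a + b) \<in> V" if kab: "k \<in> K" "a \<in> W" "b \<in> W" for k a b
  proof -
    obtain k' where k': "k' \<in> K'" "k \<in> A k'" using K'(3) kab(1) by blast
    have "a + b \<in> B k'" using W(4) kab k' by blast
    then have "(k, a + b) \<in> P" using AB[of k'] K'(1) k' by blast
    then show ?thesis by (simp add: P_def)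
  qed
  define V' where "V' = (\<Union>x\<in>K. \<Union>y\<in>W. {x + y})"
  have "open V'" unfolding V'_def using W(1) by (rule open_sums_lc)
  moreover have "K \<subseteq> V'"
  proof
    fix k assume "k \<in> K"
    then have "k + 0 \<in> V'" unfolding V'_def using W(3) by blast
    then show "k \<in> V'" by simp
  qed
  moreover have "closure V' \<subseteq> V"
  proof
    fix y assume y: "y \<in> closure V'"
    \<comment> \<open>The points \<open>v\<close> with \<open>y - v \<in> W\<close> form a
      neighbourhood of \<open>y\<close>, which therefore meets \<open>V'\<close>; this writes
      \<open>y\<close> as \<open>k + (w + (y - v))\<close>.\<close>
    have "open ((\<lambda>v. y - v) -` W)" "y \<in> (\<lambda>v. y - v) -` W"
      using W(1,3) by (auto intro!: open_vimage continuous_intros)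
    then obtain v where "v \<in> V'" "y - v \<in> W"
      using y open_Int_closure_eq_empty[of "(\<lambda>v. y - v) -` W" V'] by blast
    then obtain k w where "k \<in> K" "w \<in> W" "v = k + w" by (auto simp: V'_def)
    then show "y \<in> V" using KW[of k w "y - v"] \<open>y - v \<in> W\<close> by simp
  qed
  moreover have "convex V'" if "convex K" unfolding V'_def using that W(2) by (rule convex_sums)
  ultimately show ?thesis by (rule that)
qed

section \<open>Separation of a point from a closed convex set\<close>

text \<open>This is the Minkowski functional of \<open>U\<close>. An open set around 0 absorbs every
  point, so the infimum runs over a nonempty set; convexity gives subadditivity.\<close>

lemma gauge_sublinear:
  fixes U :: "'b::hausdorff_locally_convex set"
  assumes U: "open U" "convex U" "0 \<in> U"
  obtains p where "sublinear p" "\<And>x. x \<in> U \<Longrightarrow> p x \<le> 1" "\<And>x. x \<notin> U \<Longrightarrow> 1 \<le> p x"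
proof -
  define S where "S x = {t::real. t > 0 \<and> inverse t *\<^sub>R x \<in> U}" for x
  define p where "p x = Inf (S x)" for x
  have ne: "S x \<noteq> {}" for x
  proof -
    have "open ((\<lambda>t::real. t *\<^sub>R x) -` U)"
      using U(1) by (intro open_vimage continuous_on_scaleR_lc continuous_intros)
    moreover have "0 \<in> (\<lambda>t::real. t *\<^sub>R x) -` U" using U(3) by simp
    ultimately obtain e where "e > 0" "ball 0 e \<subseteq> (\<lambda>t::real. t *\<^sub>R x) -` U"
      by (meson open_contains_ball)
    then have "(e / 2) *\<^sub>R x \<in> U" by (auto simp: subset_iff dist_norm)
    then have "inverse (e / 2) \<in> S x" using \<open>e > 0\<close> by (simp add: S_def)
    then show ?thesis by blast
  qed
  have low: "p x \<le> t" if "t \<in> S x" for x t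
    unfolding p_def using that by (rule cInf_lower) (auto simp: S_def bdd_below_def intro!: exI[of _ 0])
  have great: "c \<le> p x" if "\<And>t. t \<in> S x \<Longrightarrow> c \<le> t" for c x
    unfolding p_def using ne that by (rule cInf_greatest)
  have "sublinear p"
    unfolding sublinear_def
  proof (intro conjI allI impI)
    fix x y
    have 1: "p (x + y) \<le> s + t" if s: "s \<in> S x" and t: "t \<in> S y" for s t
    proof (rule low)
      have st: "s > 0" "t > 0" "inverse s *\<^sub>R x \<in> U" "inverse t *\<^sub>R y \<in> U"
        using s t by (auto simp: S_def)
      \<comment> \<open>These weights combine the two scaled points of \<open>U\<close> into
        \<open>inverse (s + t) *\<^sub>R (x + y)\<close>.\<close>
      then have "(s / (s + t)) *\<^sub>R (inverse s *\<^sub>R x) + (t / (s + t)) *\<^sub>R (inverse t *\<^sub>R y) \<in> U"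
        using U(2) by (intro convexD) (auto simp flip: add_divide_distrib)
      then have "inverse (s + t) *\<^sub>R (x + y) \<in> U"
        using st by (simp add: scaleR_add_right field_simps)
      then show "s + t \<in> S (x + y)" using st by (simp add: S_def)
    qed
    have "p (x + y) - t \<le> p x" if "t \<in> S y" for t
      using 1[OF _ that] by (intro great) (simp add: algebra_simps)
    then have "p (x + y) - p x \<le> p y"
      by (intro great) (simp add: algebra_simps)
    then show "p (x + y) \<le> p x + p y" by simp
  next
    fix x and c :: real assume c: "c > 0"
    have "p (c *\<^sub>R x) / c \<le> p x"
    proof (rule great)
      fix t assume t: "t \<in> S x"
      have "inverse (c * t) * c = inverse t" using c by (simp add: field_simps)
      then have "inverse (c * t) *\<^sub>R c *\<^sub>R x = inverse t *\<^sub>R x" unfolding scaleR_scaleR by simp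
      moreover have "c * t > 0" using c t by (simp add: S_def)
      ultimately have "c * t \<in> S (c *\<^sub>R x)" using t unfolding S_def mem_Collect_eq by metis
      from low[OF this] show "p (c *\<^sub>R x) / c \<le> t" using c by (simp add: field_simps)
    qed
    then show "p (c *\<^sub>R x) \<le> c * p x" using c by (simp add: field_simps)
  qed
  moreover have "p x \<le> 1" if "x \<in> U" for x
    using that by (intro low) (simp add: S_def)
  moreover have "1 \<le> p x" if "x \<notin> U" for x
  proof (rule great, rule ccontr)
    fix t assume t: "t \<in> S x" "\<not> 1 \<le> t"
    \<comment> \<open>For \<open>t < 1\<close> the point \<open>x\<close> is a convex combination of
      a point of \<open>U\<close> and 0, hence would lie in \<open>U\<close>.\<close>
    then have "t *\<^sub>R (inverse t *\<^sub>R x) + (1 - t) *\<^sub>R 0 \<in> U"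
      using U(2,3) by (intro convexD) (auto simp: S_def)
    then show False using t that by (simp add: S_def)
  qed
  ultimately show ?thesis by (rule that)
qed

text \<open>On a symmetric neighbourhood inside \<open>U\<close> the upper bound becomes two-sided;
  linearity then allows scaling and translating it to any point.\<close>

lemma linear_bounded_nhd_imp_continuous:
  fixes h :: "'b::hausdorff_locally_convex \<Rightarrow> real"
  assumes h: "linear h" and U: "open U" "0 \<in> U" and le: "\<And>x. x \<in> U \<Longrightarrow> h x \<le> 1"
  shows "continuous_on UNIV h"
  unfolding continuous_on_def tendsto_iff
proof (intro ballI allI impI)
  fix x and e :: real assume e: "e > 0"
  obtain W where W: "open W" "0 \<in> W" "\<And>a b. a \<in> W \<Longrightarrow> b \<in> W \<Longrightarrow> a + b \<in> U" "\<And>a. a \<in> W \<Longrightarrow> - a \<in> W"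
    using nhds_0_symmetric_convex[OF U] by metis
  \<comment> \<open>The factor \<open>2 / e\<close> bounds the difference of values by
    \<open>e / 2\<close>, which leaves the inequality strict.\<close>
  define N where "N = (\<lambda>y. (2 / e) *\<^sub>R (y - x)) -` W"
  have "open N" unfolding N_def
    using W(1) by (intro open_vimage continuous_on_scaleR_lc continuous_intros)
  moreover have "x \<in> N" using W(2) by (simp add: N_def)
  moreover have "dist (h y) (h x) < e" if "y \<in> N" for y
  proof -
    define w where "w = (2 / e) *\<^sub>R (y - x)"
    have "w \<in> W" using that by (simp add: N_def w_def)
    then have "w \<in> U" "- w \<in> U" using W(3)[of w 0] W(3)[of "- w" 0] W(2,4) by auto
    then have "\<bar>h w\<bar> \<le> 1" using le[of w] le[of "- w"] linear_neg[OF h, of w] by auto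
    moreover have "h w = (2 / e) * (h y - h x)"
      unfolding w_def using linear_scale[OF h, of "2 / e" "y - x"] linear_diff[OF h, of y x] by simp
    ultimately have "(2 / e) * \<bar>h y - h x\<bar> \<le> 1" using e by (metis abs_mult abs_of_pos zero_less_divide_iff zero_less_numeral)
    then show ?thesis using e by (simp add: dist_real_def field_simps)
  qed
  ultimately show "\<forall>\<^sub>F y in at x within UNIV. dist (h y) (h x) < e"
    by (auto simp: eventually_at_topological)
qed

text \<open>Hahn-Banach for the gauge of a convex neighbourhood \<open>U\<close> of 0 that avoids
  \<open>c0 - y\<close> gives \<open>h \<le> 1\<close> on \<open>U\<close> and
  \<open>1 \<le> h (c0 - y)\<close>. Evaluating \<open>h\<close> at points \<open>c0 - z + w\<close>
  of \<open>U\<close> pushes \<open>h z\<close> above \<open>h y\<close>.\<close>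

lemma separating_functional:
  fixes C :: "'b::hausdorff_locally_convex set"
  assumes C: "closed C" "convex C" "C \<noteq> {}" and y: "y \<notin> C"
  obtains h :: "'b \<Rightarrow> real" and c where "linear h" "continuous_on UNIV h" "h \<noteq> (\<lambda>_. 0)"
    "h y < c" "\<And>z. z \<in> C \<Longrightarrow> c < h z"
proof -
  obtain c0 where c0: "c0 \<in> C" using C(3) by blast
  have "open ((\<lambda>w. y + w) -` (- C))"
    using C(1) by (intro open_vimage continuous_intros) auto
  moreover have "0 \<in> (\<lambda>w. y + w) -` (- C)" using y by simp
  ultimately obtain W where W: "open W" "convex W" "0 \<in> W" "W \<subseteq> (\<lambda>w. y + w) -` (- C)"
    using locally_convex_at_0 by blast
  \<comment> \<open>\<open>C\<close> misses \<open>y + W\<close>, so \<open>U = c0 - C + W\<close> misses \<open>c0 - y\<close>.\<close>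
  define U where "U = (\<Union>x\<in>(\<lambda>z. c0 - z) ` C. \<Union>w\<in>W. {x + w})"
  have U: "open U" unfolding U_def using W(1) by (rule open_sums_lc)
  moreover have "convex U" unfolding U_def
  proof (rule convex_sums)
    have "(\<lambda>z. c0 - z) ` C = (\<lambda>z. c0 + z) ` uminus ` C" by (simp add: image_image)
    then show "convex ((\<lambda>z. c0 - z) ` C)"
      using C(2) by (metis convex_negations convex_translation)
  qed (rule W)
  moreover have "c0 - c0 + 0 \<in> U" unfolding U_def using c0 W(3) by blast
  then have U0: "0 \<in> U" by simp
  ultimately obtain p where p: "sublinear p" "\<And>x. x \<in> U \<Longrightarrow> p x \<le> 1" "\<And>x. x \<notin> U \<Longrightarrow> 1 \<le> p x"
    by (rule gauge_sublinear) blast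
  obtain h where h: "linear h" "h \<le> p" "h (c0 - y) = p (c0 - y)"
    using hahn_banach_sublinear[OF p(1)] by blast
  have hU: "h x \<le> 1" if "x \<in> U" for x
    using p(2)[OF that] le_funD[OF h(2), of x] by simp
  have "c0 - y \<notin> U"
  proof
    assume "c0 - y \<in> U"
    then obtain z w where "z \<in> C" "w \<in> W" "c0 - y = c0 - z + w" by (auto simp: U_def)
    then have "y + w \<in> C" by (simp add: algebra_simps)
    then show False using W(4) \<open>w \<in> W\<close> by auto
  qed
  then have h1: "1 \<le> h (c0 - y)" using p(3) h(3) by simp
  have cont: "continuous_on UNIV h"
    using h(1) U U0 hU by (rule linear_bounded_nhd_imp_continuous)
  \<comment> \<open>A small multiple of \<open>c0 - y\<close> lies in \<open>W\<close>, and
    \<open>h\<close> is at least \<open>e / 2\<close> there. This gives a gap independent of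
    \<open>z\<close>, into which \<open>c = h y + e / 4\<close> fits strictly.\<close>
  have "open ((\<lambda>t::real. t *\<^sub>R (c0 - y)) -` W)"
    using W(1) by (intro open_vimage continuous_on_scaleR_lc continuous_intros)
  moreover have "0 \<in> (\<lambda>t::real. t *\<^sub>R (c0 - y)) -` W" using W(3) by simp
  ultimately obtain e where e: "e > 0" "ball 0 e \<subseteq> (\<lambda>t::real. t *\<^sub>R (c0 - y)) -` W"
    by (meson open_contains_ball)
  then have eW: "(e / 2) *\<^sub>R (c0 - y) \<in> W" by (auto simp: subset_iff dist_norm)
  have he: "h ((e / 2) *\<^sub>R (c0 - y)) \<ge> e / 2"
    using h1 e(1) linear_scale[OF h(1), of "e / 2" "c0 - y"] by simp
  have gap: "h y + e / 2 \<le> h z" if "z \<in> C" for z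
  proof -
    have "c0 - z + (e / 2) *\<^sub>R (c0 - y) \<in> U" using that eW by (auto simp: U_def)
    from hU[OF this] show ?thesis
      using he h1 by (simp add: linear_add[OF h(1)] linear_diff[OF h(1)])
  qed
  have "h y + e / 4 < h z" if "z \<in> C" for z
    using gap[OF that] e(1) by linarith
  moreover have "h \<noteq> (\<lambda>_. 0)" using h1 by auto
  ultimately show ?thesis
    using h(1) cont e(1) by (intro that[of h "h y + e / 4"]) auto
qed


section \<open>Closed convex hulls\<close>

lemma closed_convex_hull_minimal:
  assumes "B \<subseteq> C" "closed C" "convex C"
  shows "closed_convex_hull B \<subseteq> C"
  unfolding closed_convex_hull_def
  using assms by (intro closure_minimal hull_minimal)

lemma closed_convex_hull_superset: "B \<subseteq> closed_convex_hull B"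
  unfolding closed_convex_hull_def by (meson closure_subset hull_subset order_trans)

lemma convex_closed_convex_hull: "convex (closed_convex_hull B)"
  unfolding closed_convex_hull_def by (intro convex_closure_lc convex_convex_hull)

lemma closed_closed_convex_hull: "closed (closed_convex_hull B)"
  by (simp add: closed_convex_hull_def)


section \<open>Closures of graphs\<close>

text \<open>Boxes form a base of the product topology; in this form the closure of the graph can be
  handled by neighbourhoods in the two factors.\<close>

lemma mem_graph_closure_iff:
  "y \<in> graph_closure f x \<longleftrightarrow> (\<forall>A B. open A \<and> x \<in> A \<and> open B \<and> y \<in> B \<longrightarrow> (\<exists>z\<in>A. f z \<in> B))"
  (is "?L \<longleftrightarrow> ?R")
proof
  define S where "S = {(z, f z) | z. True}"
  have gc: "graph_closure f x = {y. (x, y) \<in> closure S}"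
    by (simp add: graph_closure_def S_def)
  show ?R if ?L
  proof (intro allI impI)
    fix A B assume AB: "open A \<and> x \<in> A \<and> open B \<and> y \<in> B"
    then have "(A \<times> B) \<inter> closure S \<noteq> {}"
      using that gc by blast
    then have "(A \<times> B) \<inter> S \<noteq> {}"
      using AB open_Int_closure_eq_empty[of "A \<times> B" S] by (simp add: open_Times)
    then show "\<exists>z\<in>A. f z \<in> B" by (auto simp: S_def)
  qed
  show ?L if R: ?R
  proof (rule ccontr)
    assume "\<not> ?L"
    then have "open (- closure S)" "(x, y) \<in> - closure S" using gc by auto
    then obtain A B where AB: "open A" "open B" "(x, y) \<in> A \<times> B" "A \<times> B \<subseteq> - closure S"
      by (rule open_prod_elim)
    then obtain z where "z \<in> A" "f z \<in> B" using R by blast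
    moreover have "(z, f z) \<in> closure S" using closure_subset[of S] by (auto simp: S_def)
    ultimately show False using AB(4) by blast
  qed
qed

lemma closed_graph_closure: "closed (graph_closure f x)"
proof -
  have "graph_closure f x = (\<lambda>y. (x, y)) -` closure {(z, f z) | z. True}"
    by (auto simp: graph_closure_def)
  then show ?thesis by (auto intro!: closed_vimage continuous_intros)
qed

lemma graph_closure_refl: "f x \<in> graph_closure f x"
  unfolding mem_graph_closure_iff by blast

text \<open>For \<open>y\<close> outside \<open>S\<close> the open box
  \<open>A \<times> (- S)\<close> around \<open>(x, y)\<close> misses the graph.\<close>

lemma graph_closure_subset_closed:
  assumes "open A" "x \<in> A" "f ` A \<subseteq> S" "closed S"
  shows "graph_closure f x \<subseteq> S"
proof
  fix y assume y: "y \<in> graph_closure f x"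
  show "y \<in> S"
  proof (rule ccontr)
    assume "y \<notin> S"
    then obtain z where "z \<in> A" "f z \<in> - S"
      using y assms(1,2,4) unfolding mem_graph_closure_iff by blast
    then show False using assms(3) by blast
  qed
qed


section \<open>Upper semicontinuous compact-valued maps\<close>

lemma usco_nhd:
  assumes "usco F" "open V" "F x \<subseteq> V"
  obtains U where "open U" "x \<in> U" "\<And>u. u \<in> U \<Longrightarrow> F u \<subseteq> V"
proof -
  obtain U where "open U" "x \<in> U" "(\<Union>u\<in>U. F u) \<subseteq> V"
    using assms unfolding usco_def upper_semicontinuous_def by blast
  then show ?thesis by (intro that) blast+
qed

lemma uscoI:
  assumes "\<And>x V. open V \<Longrightarrow> F x \<subseteq> V \<Longrightarrow> \<exists>U. open U \<and> x \<in> U \<and> (\<forall>u\<in>U. F u \<subseteq> V)"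
    and "\<And>x. F x \<noteq> {}" "\<And>x. compact (F x)"
  shows "usco F"
  unfolding usco_def upper_semicontinuous_def
proof (intro conjI allI impI)
  fix x V assume "open V \<and> F x \<subseteq> V"
  then obtain U where "open U" "x \<in> U" "\<forall>u\<in>U. F u \<subseteq> V" using assms(1) by blast
  then show "\<exists>U. open U \<and> x \<in> U \<and> (\<Union>u\<in>U. F u) \<subseteq> V" by (intro exI[of _ U]) blast
qed (use assms in auto)

text \<open>If no member had its value at \<open>x\<close> inside \<open>V\<close>, the closed sets
  \<open>G x - V\<close> would have the finite intersection property within a compact value, and a
  common point would lie in the intersection but not in \<open>V\<close>. So a single member already
  lies in \<open>V\<close> at \<open>x\<close>, and its upper semicontinuity passes to the
  intersection.\<close>

lemma usco_chain_Inter: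
  fixes C :: "('a::topological_space \<Rightarrow> 'b::t2_space set) set"
  assumes ne: "C \<noteq> {}" and us: "\<And>G. G \<in> C \<Longrightarrow> usco G"
    and ch: "\<forall>G\<in>C. \<forall>H\<in>C. G \<le> H \<or> H \<le> G"
  shows "usco (\<lambda>x. \<Inter>G\<in>C. G x)"
proof -
  obtain G0 where G0: "G0 \<in> C" using ne by blast
  have comp: "compact (G x)" "G x \<noteq> {}" if "G \<in> C" for G x
    using us[OF that] by (auto simp: usco_def)
  \<comment> \<open>The bound also lies below \<open>G0\<close>, because the finite intersection
    property is used inside the compact set \<open>G0 x\<close>.\<close>
  have fin: "\<exists>M\<in>C. M \<le> G0 \<and> (\<forall>G\<in>I. M \<le> G)" if "finite I" "I \<subseteq> C" for I
    using that
  proof (induction rule: finite_induct)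
    case empty
    then show ?case using G0 by blast
  next
    case (insert G I)
    then obtain M where M: "M \<in> C" "M \<le> G0" "\<forall>G\<in>I. M \<le> G" by blast
    have "M \<le> G \<or> G \<le> M" using ch M(1) insert.prems by blast
    then show ?case
    proof
      assume "G \<le> M"
      then have "G \<le> G0" "\<forall>H\<in>insert G I. G \<le> H" using M order_trans by blast+
      then show ?thesis using insert.prems by blast
    qed (use M in blast)
  qed
  have key: "\<exists>G\<in>C. G x \<subseteq> V" if V: "open V" "(\<Inter>G\<in>C. G x) \<subseteq> V" for x V
  proof (rule ccontr)
    assume no: "\<not> (\<exists>G\<in>C. G x \<subseteq> V)"
    have "G0 x \<inter> (\<Inter>G\<in>C. G x - V) \<noteq> {}"
    proof (rule compact_imp_fip_image)
      show "compact (G0 x)" using comp G0 by blast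
      show "closed (G x - V)" if "G \<in> C" for G
        using comp(1)[OF that] V(1) by (intro closed_Diff compact_imp_closed)
      fix I assume I: "finite I" "I \<subseteq> C"
      then obtain M where M: "M \<in> C" "M \<le> G0" "\<forall>G\<in>I. M \<le> G" using fin by blast
      then obtain y where "y \<in> M x - V" using no by blast
      then have "y \<in> G0 x \<inter> (\<Inter>G\<in>I. G x - V)" using M(2,3) unfolding le_fun_def by blast
      then show "G0 x \<inter> (\<Inter>G\<in>I. G x - V) \<noteq> {}" by blast
    qed
    then obtain y where "y \<in> (\<Inter>G\<in>C. G x - V)" by blast
    then have "\<forall>G\<in>C. y \<in> G x - V" by blast
    then have "y \<in> (\<Inter>G\<in>C. G x)" "y \<notin> V" using G0 by blast+
    then show False using V(2) by blast
  qed
  show ?thesis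
  proof (rule uscoI)
    fix x V assume V: "open V" "(\<Inter>G\<in>C. G x) \<subseteq> V"
    then obtain G where G: "G \<in> C" "G x \<subseteq> V" using key by blast
    obtain U where "open U" "x \<in> U" "\<And>u. u \<in> U \<Longrightarrow> G u \<subseteq> V"
      by (rule usco_nhd[OF us[OF G(1)] V(1) G(2)]) blast
    then show "\<exists>U. open U \<and> x \<in> U \<and> (\<forall>u\<in>U. (\<Inter>G\<in>C. G u) \<subseteq> V)"
      using G(1) by (intro exI[of _ U]) blast
  next
    fix x
    show "(\<Inter>G\<in>C. G x) \<noteq> {}"
      \<comment> \<open>With the empty set as \<open>V\<close>, an empty intersection would force an
        empty value of some member.\<close>
      using key[of "{}" x] comp(2) by auto
    have "compact (G0 x \<inter> (\<Inter>G\<in>C. G x))"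
      using comp G0 by (intro compact_Int_closed closed_INT ballI compact_imp_closed) auto
    moreover have "G0 x \<inter> (\<Inter>G\<in>C. G x) = (\<Inter>G\<in>C. G x)" using G0 by blast
    ultimately show "compact (\<Inter>G\<in>C. G x)" by simp
  qed
qed

lemma minimal_usco_exists:
  fixes F :: "'a::topological_space \<Rightarrow> 'b::t2_space set"
  assumes "usco F"
  obtains G where "usco G" "G \<le> F" "\<And>H. usco H \<Longrightarrow> H \<le> G \<Longrightarrow> H = G"
proof -
  define A where "A = {G. usco G \<and> G \<le> F}"
  have "\<exists>G\<in>A. \<forall>H\<in>A. H \<le> G \<longrightarrow> H = G"
  proof (rule zorn_minimal)
    show "A \<noteq> {}" using assms by (auto simp: A_def)
    fix C assume C: "C \<subseteq> A" "C \<noteq> {}" and ch: "\<forall>G\<in>C. \<forall>H\<in>C. G \<le> H \<or> H \<le> G"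
    define L where "L x = (\<Inter>G\<in>C. G x)" for x
    have "usco L"
      unfolding L_def using C ch by (intro usco_chain_Inter) (auto simp: A_def)
    moreover have L: "L \<le> G" if "G \<in> C" for G
      using that by (auto simp: L_def le_fun_def)
    moreover obtain G where "G \<in> C" using C(2) by blast
    then have "L \<le> F" using L[of G] C(1) order_trans[of L G F] by (auto simp: A_def)
    ultimately show "\<exists>l\<in>A. \<forall>x\<in>C. l \<le> x" by (auto simp: A_def)
  qed
  then obtain G where G: "usco G" "G \<le> F" "\<And>H. usco H \<Longrightarrow> H \<le> F \<Longrightarrow> H \<le> G \<Longrightarrow> H = G"
    unfolding A_def by blast
  have "H = G" if "usco H" "H \<le> G" for H
    using that G(2,3) order_trans by blast
  with G(1,2) show ?thesis by (rule that)
qed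

text \<open>At points of \<open>U\<close> the set \<open>V \<union> - C\<close> is an open
  neighbourhood of the uncut value; elsewhere cutting only shrinks nearby values. Used
  contrapositively: if the cut map is not usco, some value over \<open>U\<close> misses
  \<open>C\<close>.\<close>

lemma usco_restrict_closed:
  fixes F :: "'a::topological_space \<Rightarrow> 'b::topological_space set"
  assumes F: "usco F" and U: "open U" and C: "closed C" and ne: "\<And>z. z \<in> U \<Longrightarrow> F z \<inter> C \<noteq> {}"
  shows "usco (\<lambda>z. if z \<in> U then F z \<inter> C else F z)"
proof (rule uscoI)
  fix x V assume V: "open V" "(if x \<in> U then F x \<inter> C else F x) \<subseteq> V"
  show "\<exists>N. open N \<and> x \<in> N \<and> (\<forall>u\<in>N. (if u \<in> U then F u \<inter> C else F u) \<subseteq> V)"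
  proof (cases "x \<in> U")
    case True
    then have "F x \<subseteq> V \<union> - C" "open (V \<union> - C)" using V C by auto
    then obtain N where "open N" "x \<in> N" "\<And>u. u \<in> N \<Longrightarrow> F u \<subseteq> V \<union> - C"
      using usco_nhd[OF F] by metis
    then show ?thesis using True U by (intro exI[of _ "N \<inter> U"]) auto
  next
    case False
    then obtain N where "open N" "x \<in> N" "\<And>u. u \<in> N \<Longrightarrow> F u \<subseteq> V"
      using usco_nhd[OF F V(1)] V(2) by metis
    then show ?thesis by (intro exI[of _ N]) auto
  qed
next
  fix x
  show "(if x \<in> U then F x \<inter> C else F x) \<noteq> {}" "compact (if x \<in> U then F x \<inter> C else F x)"
    using F ne C by (auto simp: usco_def intro: compact_Int_closed)
qed

text \<open>Removing \<open>interior V\<close> from the values over \<open>U\<close> loses the point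
  \<open>f x\<close>, so by minimality the cut map is not usco. Hence some value over
  \<open>U\<close> lies in \<open>interior V\<close>, and upper semicontinuity spreads this to an
  open set.\<close>

lemma minimal_usco_selection_quasicontinuous:
  fixes G :: "'a::topological_space \<Rightarrow> 'b::topological_space set"
  assumes G: "usco G" and min: "\<And>H. usco H \<Longrightarrow> H \<le> G \<Longrightarrow> H = G" and f: "selection G f"
  shows "quasicontinuous f"
  unfolding quasicontinuous_def
proof (intro allI impI)
  fix x V U assume *: "f x \<in> interior V \<and> open U \<and> x \<in> U"
  define H where "H z = (if z \<in> U then G z \<inter> - interior V else G z)" for z
  have "f x \<in> G x" using f by (simp add: selection_def)
  moreover have "f x \<notin> H x" using * by (simp add: H_def)
  ultimately have "H \<noteq> G" by auto
  moreover have "H \<le> G" by (auto simp: H_def le_fun_def)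
  ultimately have "\<not> usco H" using min by blast
  then obtain z where z: "z \<in> U" "G z \<subseteq> interior V"
    using usco_restrict_closed[OF G, of U "- interior V"] * by (auto simp: H_def[abs_def])
  obtain N where N: "open N" "z \<in> N" "\<And>u. u \<in> N \<Longrightarrow> G u \<subseteq> interior V"
    by (rule usco_nhd[OF G open_interior z(2)]) blast
  have "f ` (N \<inter> U) \<subseteq> V"
    using N(3) f interior_subset[of V] unfolding selection_def by blast
  then show "\<exists>O'. open O' \<and> O' \<noteq> {} \<and> O' \<subseteq> U \<and> f ` O' \<subseteq> V"
    using * N z by (intro exI[of _ "N \<inter> U"]) auto
qed


section \<open>Subcontinuity\<close>

lemma directed_set_finite_upper_bound:
  assumes D: "directed_set D r" and "finite K" "K \<subseteq> D"
  shows "\<exists>c\<in>D. \<forall>k\<in>K. (k, c) \<in> r"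
  using assms(2,3)
proof (induction rule: finite_induct)
  case empty
  then show ?case using D by (auto simp: directed_set_def)
next
  case (insert a K)
  then obtain c where c: "c \<in> D" "\<forall>k\<in>K. (k, c) \<in> r" by blast
  then obtain c' where c': "c' \<in> D" "(a, c') \<in> r" "(c, c') \<in> r"
    using D insert.prems unfolding directed_set_def by blast
  have "trans r" using D by (simp add: directed_set_def preorder_on_def)
  then have "\<forall>k\<in>insert a K. (k, c') \<in> r" using c c' unfolding trans_def by blast
  then show ?case using c'(1) by blast
qed

text \<open>The values along the net have a cluster point in \<open>F x\<close>: otherwise finitely
  many neighbourhoods, each eventually avoided, cover \<open>F x\<close>, while upper semicontinuity
  brings the values eventually into their union.\<close>

lemma usco_selection_subcontinuous:
  fixes F :: "'a::topological_space \<Rightarrow> 'b::topological_space set"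
  assumes F: "usco F" and f: "selection F f"
  shows "subcontinuous f"
  unfolding subcontinuous_def
proof (intro allI impI)
  fix x :: 'a and D :: "('a set \<times> 'a) set" and r u
  assume Du: "directed_set D r \<and> net_converges D r u x"
  \<comment> \<open>\<open>P y V d\<close> says that \<open>V\<close> and \<open>d\<close> witness
    that \<open>y\<close> is not a cluster point.\<close>
  define P where "P y V d \<longleftrightarrow> open V \<and> y \<in> V \<and> d \<in> D \<and> (\<forall>e\<in>D. (d, e) \<in> r \<longrightarrow> f (u e) \<notin> V)"
    for y V d
  have "\<exists>y\<in>F x. \<forall>V d. \<not> P y V d"
  proof (rule ccontr)
    assume "\<not> ?thesis"
    then have "\<forall>y\<in>F x. \<exists>V d. P y V d" by simp
    then obtain V d where "\<forall>y\<in>F x. P y (V y) (d y)" by metis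
    then have Vd: "open (V y)" "y \<in> V y" "d y \<in> D"
        "\<And>e. e \<in> D \<Longrightarrow> (d y, e) \<in> r \<Longrightarrow> f (u e) \<notin> V y" if "y \<in> F x" for y
      using that by (simp_all add: P_def)
    have "compact (F x)" using F by (simp add: usco_def)
    then obtain K where K: "K \<subseteq> F x" "finite K" "F x \<subseteq> (\<Union>y\<in>K. V y)"
    proof (rule compactE_image[of "F x" "F x" V])
      show "open (V y)" if "y \<in> F x" for y using Vd(1)[OF that] .
      show "F x \<subseteq> (\<Union>y\<in>F x. V y)" using Vd(2) by blast
    qed
    have "open (\<Union>y\<in>K. V y)" using K(1) Vd(1) by (intro open_UN) blast
    then obtain N where N: "open N" "x \<in> N" "\<And>z. z \<in> N \<Longrightarrow> F z \<subseteq> (\<Union>y\<in>K. V y)"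
      using usco_nhd[OF F _ K(3)] by blast
    have "\<exists>d\<in>D. \<forall>e\<in>D. (d, e) \<in> r \<longrightarrow> u e \<in> N"
      using Du N(1,2) unfolding net_converges_def by simp
    then obtain d0 where d0: "d0 \<in> D" "\<And>e. e \<in> D \<Longrightarrow> (d0, e) \<in> r \<Longrightarrow> u e \<in> N"
      by blast
    have "insert d0 (d ` K) \<subseteq> D" using d0(1) K(1) Vd(3) by blast
    then obtain c where c: "c \<in> D" "\<forall>k\<in>insert d0 (d ` K). (k, c) \<in> r"
      using directed_set_finite_upper_bound[of D r "insert d0 (d ` K)"] Du K(2) by blast
    then have "F (u c) \<subseteq> (\<Union>y\<in>K. V y)" using N(3) d0(2)[of c] by blast
    moreover have "f (u c) \<in> F (u c)" using f by (simp add: selection_def)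
    ultimately have "f (u c) \<in> (\<Union>y\<in>K. V y)" by blast
    then obtain y where "y \<in> K" "f (u c) \<in> V y" by blast
    then show False using Vd(4)[of y c] K(1) c by blast
  qed
  then obtain y where "\<And>V d. \<not> P y V d" by blast
  then have y: "\<exists>e\<in>D. (d, e) \<in> r \<and> f (u e) \<in> V" if "open V" "y \<in> V" "d \<in> D" for V d
    using that unfolding P_def by blast
  have "\<exists>(E :: (('a set \<times> 'a) \<times> 'b set) set) s \<phi>.
      subnet_along D r E s \<phi> \<and> net_converges E s (\<lambda>e. f (u (\<phi> e))) y"
    using Du y by (intro cluster_imp_convergent_subnet) auto
  then show "\<exists>(E :: (('a set \<times> 'a) \<times> 'b set) set) s \<phi> y.
      subnet_along D r E s \<phi> \<and> net_converges E s (\<lambda>e. f (u (\<phi> e))) y"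
    by blast
qed

text \<open>Otherwise the pairs of a neighbourhood of \<open>x\<close> and a point in it with value
  outside \<open>V\<close> index a net converging to \<open>x\<close>. A cluster point of the values
  lies in \<open>graph_closure f x\<close>, hence in \<open>V\<close>, which all these values
  avoid.\<close>

lemma subcontinuous_nhd:
  fixes f :: "'a::topological_space \<Rightarrow> 'b::topological_space"
  assumes f: "subcontinuous f" and V: "open V" "graph_closure f x \<subseteq> V"
  obtains U where "open U" "x \<in> U" "f ` U \<subseteq> V"
proof (rule ccontr)
  assume "\<not> thesis"
  then have no: "\<And>U. open U \<Longrightarrow> x \<in> U \<Longrightarrow> \<exists>a\<in>U. f a \<notin> V" using that by blast
  define D where "D = {(A, a). open A \<and> x \<in> A \<and> a \<in> A \<and> f a \<notin> V}"
  define r where "r = {(p, q). p \<in> D \<and> q \<in> D \<and> fst q \<subseteq> fst p}"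
  have dir: "directed_set D r"
    unfolding directed_set_def
  proof (intro conjI ballI)
    show "D \<noteq> {}" using no[of UNIV] by (auto simp: D_def)
    show "preorder_on D r"
      unfolding preorder_on_def by (auto simp: r_def refl_on_def trans_def)
    fix p q assume pq: "p \<in> D" "q \<in> D"
    then have "open (fst p \<inter> fst q)" "x \<in> fst p \<inter> fst q" by (auto simp: D_def)
    then obtain a where "a \<in> fst p \<inter> fst q" "f a \<notin> V" using no by blast
    then show "\<exists>c\<in>D. (p, c) \<in> r \<and> (q, c) \<in> r"
      using pq by (intro bexI[of _ "(fst p \<inter> fst q, a)"]) (auto simp: r_def D_def)
  qed
  have conv: "net_converges D r snd x"
    unfolding net_converges_def
  proof (intro allI impI)
    fix U assume U: "open U \<and> x \<in> U"
    then obtain a where "a \<in> U" "f a \<notin> V" using no by blast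
    then show "\<exists>d\<in>D. \<forall>e\<in>D. (d, e) \<in> r \<longrightarrow> snd e \<in> U"
      using U by (intro bexI[of _ "(U, a)"]) (auto simp: r_def D_def)
  qed
  obtain E :: "(('a set \<times> 'a) \<times> 'b set) set" and s \<phi> y
    where E: "subnet_along D r E s \<phi>" "net_converges E s (\<lambda>e. f (snd (\<phi> e))) y"
    using f dir conv unfolding subcontinuous_def by blast
  have cl: "\<exists>e\<in>D. (d, e) \<in> r \<and> f (snd e) \<in> B" if "open B" "y \<in> B" "d \<in> D" for B d
    using convergent_subnet_imp_cluster[OF E(1), of "\<lambda>e. f (snd e)"] E(2) that by blast
  have "y \<in> graph_closure f x"
    unfolding mem_graph_closure_iff
  proof (intro allI impI)
    fix A B assume AB: "open A \<and> x \<in> A \<and> open B \<and> y \<in> B"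
    then obtain a where "a \<in> A" "f a \<notin> V" using no by blast
    then have "(A, a) \<in> D" using AB by (simp add: D_def)
    then obtain e where "e \<in> D" "((A, a), e) \<in> r" "f (snd e) \<in> B" using cl AB by blast
    then show "\<exists>z\<in>A. f z \<in> B" by (intro bexI[of _ "snd e"]) (auto simp: D_def r_def)
  qed
  then have "y \<in> V" using V(2) by blast
  moreover obtain d where "d \<in> D" using dir by (auto simp: directed_set_def)
  ultimately obtain e where "e \<in> D" "f (snd e) \<in> V" using cl V(1) by blast
  then show False by (auto simp: D_def)
qed

text \<open>Values of \<open>f\<close> in an open set only place the graph closure in its closure,
  so \<open>V\<close> is first shrunk to \<open>V'\<close> with
  \<open>closure V' \<subseteq> V\<close>.\<close>

lemma subcontinuous_usco_graph_closure:
  fixes f :: "'a::topological_space \<Rightarrow> 'b::hausdorff_locally_convex"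
  assumes f: "subcontinuous f" and K: "\<And>x. compact (graph_closure f x)"
  shows "usco (graph_closure f)"
proof (rule uscoI)
  fix x V assume V: "open V" "graph_closure f x \<subseteq> V"
  obtain V' where V': "open V'" "graph_closure f x \<subseteq> V'" "closure V' \<subseteq> V"
    using compact_open_separation[OF K V] .
  obtain U where U: "open U" "x \<in> U" "f ` U \<subseteq> V'"
    using subcontinuous_nhd[OF f V'(1,2)] .
  have "graph_closure f u \<subseteq> V" if "u \<in> U" for u
    using graph_closure_subset_closed[OF U(1) that, of f "closure V'"] U(3) V'(3)
      closure_subset[of V'] by auto
  then show "\<exists>U. open U \<and> x \<in> U \<and> (\<forall>u\<in>U. graph_closure f u \<subseteq> V)" using U by blast
qed (use K graph_closure_refl in blast)+

text \<open>An usco map into a Hausdorff locally convex space has closed graph: a point outside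
  \<open>F x\<close> is separated from it by an open set whose closure misses the point.\<close>

lemma usco_selection_graph_closure_subset:
  fixes F :: "'a::topological_space \<Rightarrow> 'b::hausdorff_locally_convex set"
  assumes F: "usco F" and f: "selection F f"
  shows "graph_closure f x \<subseteq> F x"
proof
  fix y assume y: "y \<in> graph_closure f x"
  show "y \<in> F x"
  proof (rule ccontr)
    assume "y \<notin> F x"
    moreover have "compact (F x)" using F by (simp add: usco_def)
    ultimately obtain V where V: "open V" "F x \<subseteq> V" "closure V \<subseteq> - {y}"
      using compact_open_separation[of "F x" "- {y}"] by auto
    obtain U where U: "open U" "x \<in> U" "\<And>u. u \<in> U \<Longrightarrow> F u \<subseteq> V"
      by (rule usco_nhd[OF F V(1,2)]) blast
    have "f ` U \<subseteq> closure V"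
      using U(3) f closure_subset[of V] unfolding selection_def by blast
    then show False using graph_closure_subset_closed[OF U(1,2), of f "closure V"] y V(3) by auto
  qed
qed


section \<open>Minimal cusco maps\<close>

text \<open>The enclosing set \<open>V'\<close> can be taken convex, so once it contains
  \<open>G u\<close> its closure contains the whole closed convex hull.\<close>

lemma cusco_closed_convex_hull:
  fixes G :: "'a::topological_space \<Rightarrow> 'b::hausdorff_locally_convex set"
  assumes G: "usco G" and K: "\<And>x. compact (closed_convex_hull (G x))"
  shows "cusco (\<lambda>x. closed_convex_hull (G x))"
  unfolding cusco_def
proof (intro conjI allI uscoI)
  fix x V assume V: "open V" "closed_convex_hull (G x) \<subseteq> V"
  obtain V' where V': "open V'" "closed_convex_hull (G x) \<subseteq> V'" "closure V' \<subseteq> V" "convex V'"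
    using compact_open_separation[OF K V] convex_closed_convex_hull by metis
  have "G x \<subseteq> V'" using closed_convex_hull_superset V'(2) by (rule order_trans)
  then obtain U where U: "open U" "x \<in> U" "\<And>u. u \<in> U \<Longrightarrow> G u \<subseteq> V'"
    using usco_nhd[OF G V'(1)] by blast
  have "closed_convex_hull (G u) \<subseteq> V" if "u \<in> U" for u
  proof -
    have "closed_convex_hull (G u) \<subseteq> closure V'"
      using U(3)[OF that] V'(4) closure_subset[of V']
      by (intro closed_convex_hull_minimal convex_closure_lc) auto
    then show ?thesis using V'(3) by blast
  qed
  then show "\<exists>U. open U \<and> x \<in> U \<and> (\<forall>u\<in>U. closed_convex_hull (G u) \<subseteq> V)" using U by blast
next
  fix x
  show "closed_convex_hull (G x) \<noteq> {}"
    using G closed_convex_hull_superset[of "G x"] by (auto simp: usco_def)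
qed (use K convex_closed_convex_hull in auto)

lemma quasicontinuous_imp_hyperplane_minimal:
  fixes f :: "'a::topological_space \<Rightarrow> 'b::hausdorff_locally_convex"
  assumes "quasicontinuous f"
  shows "hyperplane_minimal (\<lambda>x. {f x})"
  unfolding hyperplane_minimal_def
proof (intro allI impI)
  fix W :: "'b set" and U :: "'a set"
  assume *: "open_half_space W \<and> open U \<and> (\<Union>u\<in>U. {f u}) \<inter> W \<noteq> {}"
  then have "open W" by (auto simp: open_half_space_def intro!: open_Collect_less continuous_intros)
  moreover obtain u where "u \<in> U" "f u \<in> W" using * by blast
  ultimately have "f u \<in> interior W \<and> open U \<and> u \<in> U" using * by (simp add: interior_open)
  then obtain G where "open G" "G \<noteq> {}" "G \<subseteq> U" "f ` G \<subseteq> W"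
    using assms[unfolded quasicontinuous_def, rule_format, of u W U] by blast
  then show "\<exists>V. open V \<and> V \<noteq> {} \<and> V \<subseteq> U \<and> (\<Union>v\<in>V. {f v}) \<subseteq> W" by blast
qed

lemma subcontinuous_hyperplane_minimal_imp_minimal_cusco:
  fixes F :: "'a::topological_space \<Rightarrow> 'b::hausdorff_locally_convex set"
  assumes K: "\<And>x. compact (F x)" and sub: "subcontinuous f"
    and hyp: "hyperplane_minimal (\<lambda>x. {f x})"
    and hull: "\<And>x. closed_convex_hull (graph_closure f x) = F x"
  shows "minimal_cusco F"
proof -
  have "compact (graph_closure f x)" for x
  proof -
    \<comment> \<open>The graph closure lies in its hull \<open>F x\<close>, so it is a closed
      subset of a compact set.\<close>
    have "graph_closure f x = F x \<inter> graph_closure f x"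
      using closed_convex_hull_superset[of "graph_closure f x"] hull by auto
    then show ?thesis using K closed_graph_closure compact_Int_closed by metis
  qed
  then have "usco (graph_closure f)" using sub by (intro subcontinuous_usco_graph_closure)
  then have "cusco F"
    using cusco_closed_convex_hull[of "graph_closure f"] hull K by simp
  moreover have "G = F" if G: "cusco G" "\<And>x. G x \<subseteq> F x" for G
  proof (rule ccontr)
    assume "G \<noteq> F"
    then obtain x where x: "G x \<noteq> F x" by blast
    have usG: "usco G" using G(1) by (simp add: cusco_def)
    have Gx: "closed (G x)" "convex (G x)" "G x \<noteq> {}"
      using G(1) by (auto simp: cusco_def usco_def intro: compact_imp_closed)
    \<comment> \<open>A closed convex value containing the graph closure would contain its hull
      \<open>F x\<close>, making \<open>G x\<close> equal to \<open>F x\<close>.\<close>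
    have "\<not> graph_closure f x \<subseteq> G x"
      using closed_convex_hull_minimal[OF _ Gx(1,2)] hull[of x] G(2)[of x] x by auto
    then obtain y where y: "y \<in> graph_closure f x" "y \<notin> G x" by blast
    obtain h :: "'b \<Rightarrow> real" and c where h: "linear h" "continuous_on UNIV h" "h \<noteq> (\<lambda>_. 0)"
      "h y < c" "\<And>z. z \<in> G x \<Longrightarrow> c < h z"
      using separating_functional[OF Gx y(2)] by metis
    have cts: "continuous_on S h" for S using h(2) by (rule continuous_on_subset) simp
    have "open {z. c < h z}" "open {z. h z < c}" "closed {z. h z \<le> c}"
      using cts by (auto intro!: open_Collect_less closed_Collect_le continuous_intros)
    note top = this
    obtain U where U: "open U" "x \<in> U" "\<And>u. u \<in> U \<Longrightarrow> G u \<subseteq> {z. c < h z}"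
      using usco_nhd[OF usG top(1), of x] h(5) by blast
    obtain u where "u \<in> U" "f u \<in> {z. h z < c}"
      using y(1) U top(2) h(4) unfolding mem_graph_closure_iff by blast
    then have "(\<Union>u\<in>U. {f u}) \<inter> {z. h z < c} \<noteq> {}" by blast
    moreover have "open_half_space {z. h z < c}" using h unfolding open_half_space_def by blast
    ultimately obtain V where V: "open V" "V \<noteq> {}" "V \<subseteq> U" "(\<Union>v\<in>V. {f v}) \<subseteq> {z. h z < c}"
      using hyp U(1) unfolding hyperplane_minimal_def by metis
    obtain v where v: "v \<in> V" using V(2) by blast
    \<comment> \<open>Strictness is lost in passing to the closure and the hull, but the bound on
      \<open>G\<close> stays strict, which is enough for the contradiction.\<close>
    have "graph_closure f v \<subseteq> {z. h z \<le> c}"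
      using V(1,4) v top(3) by (intro graph_closure_subset_closed[of V]) auto
    moreover have "convex {z. h z \<le> c}"
    proof -
      have "{z. h z \<le> c} = h -` {..c}" by auto
      then show ?thesis using h(1) convex_linear_vimage[of h "{..c}"] by simp
    qed
    ultimately have "F v \<subseteq> {z. h z \<le> c}"
      using closed_convex_hull_minimal[of "graph_closure f v" "{z. h z \<le> c}"] top(3) hull[of v] by simp
    moreover obtain z where z: "z \<in> G v" using usG by (auto simp: usco_def)
    ultimately have "h z \<le> c" using G(2)[of v] by auto
    moreover have "c < h z" using U(3)[of v] V(3) v z by auto
    ultimately show False by simp
  qed
  ultimately show ?thesis unfolding minimal_cusco_def by blast
qed

lemma minimal_cusco_selection:
  fixes F :: "'a::topological_space \<Rightarrow> 'b::hausdorff_locally_convex set"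
  assumes F: "minimal_cusco F" and f: "selection F f"
  shows "hyperplane_minimal (\<lambda>x. {f x})" "subcontinuous f"
    "closed_convex_hull (graph_closure f x) = F x"
proof -
  have cF: "cusco F" and us: "usco F" and K: "\<And>x. compact (F x)" and cv: "\<And>x. convex (F x)"
    using F by (auto simp: minimal_cusco_def cusco_def usco_def)
  have min: "G = F" if "cusco G" "\<And>x. G x \<subseteq> F x" for G
    using F that unfolding minimal_cusco_def by blast
  show sub: "subcontinuous f" using us f by (rule usco_selection_subcontinuous)
  have gc: "graph_closure f x \<subseteq> F x" for x
    using us f by (rule usco_selection_graph_closure_subset)
  have hull: "closed_convex_hull (graph_closure f x) \<subseteq> F x" for x
    using gc cv K by (intro closed_convex_hull_minimal compact_imp_closed)
  have closed_sub: "compact C" if "closed C" "C \<subseteq> F x" for C x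
    using compact_Int_closed[OF K that(1), of x] that(2) by (simp add: Int_absorb1)
  have "usco (graph_closure f)"
    using sub closed_sub[OF closed_graph_closure gc] by (rule subcontinuous_usco_graph_closure)
  then have "cusco (\<lambda>x. closed_convex_hull (graph_closure f x))"
    using closed_sub[OF closed_closed_convex_hull hull] by (rule cusco_closed_convex_hull)
  then show "closed_convex_hull (graph_closure f x) = F x" using min hull by metis
  show "hyperplane_minimal (\<lambda>x. {f x})"
    unfolding hyperplane_minimal_def
  proof (intro allI impI)
    fix W :: "'b set" and U :: "'a set"
    assume *: "open_half_space W \<and> open U \<and> (\<Union>u\<in>U. {f u}) \<inter> W \<noteq> {}"
    then obtain h :: "'b \<Rightarrow> real" and c where h: "linear h" "continuous_on UNIV h" "W = {y. h y < c}"
      unfolding open_half_space_def by blast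
    have oW: "open W" unfolding h(3) using h(2) by (intro open_Collect_less continuous_intros)
    obtain u where u: "u \<in> U" "f u \<in> W" using * by blast
    \<comment> \<open>Over \<open>U\<close> the half-space is cut away; the point \<open>f u\<close>
      is lost, so \<open>G\<close> is a proper submap.\<close>
    define G where "G z = (if z \<in> U then F z \<inter> - W else F z)" for z
    have "f u \<in> F u" using f by (simp add: selection_def)
    moreover have "f u \<notin> G u" using u by (simp add: G_def)
    ultimately have "G \<noteq> F" by auto
    moreover have "G z \<subseteq> F z" for z by (auto simp: G_def)
    ultimately have "\<not> cusco G" using min by blast
    \<comment> \<open>The complement of a half-space is convex, so \<open>G\<close> can fail to be
      cusco only by failing to be usco.\<close>
    moreover have "- W = h -` {c..}" by (auto simp: h(3))
    then have "convex (- W)" using h(1) convex_linear_vimage[of h "{c..}"] by simp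
    then have "convex (G z)" for z using cv by (simp add: G_def convex_Int)
    ultimately have "\<not> usco G" by (simp add: cusco_def)
    then obtain z where z: "z \<in> U" "F z \<subseteq> W"
      using usco_restrict_closed[OF us, of U "- W"] * oW by (auto simp: G_def[abs_def])
    obtain N where N: "open N" "z \<in> N" "\<And>u. u \<in> N \<Longrightarrow> F u \<subseteq> W"
      by (rule usco_nhd[OF us oW z(2)]) blast
    have "(\<Union>v\<in>N \<inter> U. {f v}) \<subseteq> W"
      using N(3) f unfolding selection_def by blast
    then show "\<exists>V. open V \<and> V \<noteq> {} \<and> V \<subseteq> U \<and> (\<Union>v\<in>V. {f v}) \<subseteq> W"
      using * N z by (intro exI[of _ "N \<inter> U"]) auto
  qed
qed

text \<open>Cutting by an arbitrary open set destroys convexity of values, so the selection is taken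
  from a minimal usco submap, where no convexity has to be preserved.\<close>

lemma minimal_cusco_quasicontinuous_selection:
  fixes F :: "'a::topological_space \<Rightarrow> 'b::hausdorff_locally_convex set"
  assumes "minimal_cusco F"
  obtains f where "selection F f" "quasicontinuous f"
proof -
  have "usco F" using assms by (simp add: minimal_cusco_def cusco_def)
  then obtain G where G: "usco G" "G \<le> F" "\<And>H. usco H \<Longrightarrow> H \<le> G \<Longrightarrow> H = G"
    using minimal_usco_exists by blast
  define f where "f x = (SOME y. y \<in> G x)" for x
  have f: "selection G f"
    using G(1) unfolding selection_def f_def by (auto simp: usco_def some_in_eq)
  then have "selection F f" using G(2) by (auto simp: selection_def le_fun_def)
  moreover have "quasicontinuous f"
    using G(1,3) f by (rule minimal_usco_selection_quasicontinuous)
  ultimately show ?thesis by (rule that)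
qed

theorem theorem2p2:
  fixes F :: "'a::t2_space \<Rightarrow> 'b::hausdorff_locally_convex set"
  shows "(minimal_cusco F \<longleftrightarrow>
            (\<forall>x. F x \<noteq> {} \<and> compact (F x)) \<and>
            (\<exists>f. selection F f \<and> quasicontinuous f \<and> subcontinuous f \<and>
                 (\<forall>x. closed_convex_hull (graph_closure f x) = F x))) \<and>
         (minimal_cusco F \<longleftrightarrow>
            (\<forall>x. F x \<noteq> {} \<and> compact (F x)) \<and>
            (\<exists>f. selection F f \<and> hyperplane_minimal (\<lambda>x. {f x}) \<and> subcontinuous f \<and>
                 (\<forall>x. closed_convex_hull (graph_closure f x) = F x))) \<and>
         (minimal_cusco F \<longleftrightarrow>
            (\<forall>x. F x \<noteq> {} \<and> compact (F x)) \<and>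
            (\<forall>f. selection F f \<longrightarrow>
                 hyperplane_minimal (\<lambda>x. {f x}) \<and> subcontinuous f \<and>
                 (\<forall>x. closed_convex_hull (graph_closure f x) = F x)))"
  (is "(?m \<longleftrightarrow> ?k \<and> ?q) \<and> (?m \<longleftrightarrow> ?k \<and> ?e) \<and> (?m \<longleftrightarrow> ?k \<and> ?a)")
proof -
  have mk: ?k if ?m
    using that by (simp add: minimal_cusco_def cusco_def usco_def)
  have ma: ?a if ?m
    using minimal_cusco_selection[OF that] by blast
  have mq: ?q if ?m
    using minimal_cusco_quasicontinuous_selection[OF that] minimal_cusco_selection[OF that] by metis
  have qe: ?e if ?q
    using that quasicontinuous_imp_hyperplane_minimal by blast
  \<comment> \<open>Nonempty values provide at least one selection, so the universal condition
    implies the existential one.\<close>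
  have ae: ?e if ?k ?a
  proof -
    have "selection F (\<lambda>x. SOME y. y \<in> F x)"
      using that(1) by (auto simp: selection_def some_in_eq)
    with that(2) show ?thesis by blast
  qed
  have em: ?m if ?k ?e
    using that subcontinuous_hyperplane_minimal_imp_minimal_cusco by metis
  show ?thesis using mk ma mq qe ae em by argo
qed

end
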